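(* Let $S=\mathbb{K}[x_1,\ldots,x_n]$ be a polynomial ring over a field $\mathbb{K}$, and let $I=(u_1,u_2,x_1^{e_1},\ldots,x_n^{e_n})$, where $u_1=x_1^{a_1}\cdots x_n^{a_n}$ and $u_2=x_1^{b_1}\cdots x_n^{b_n}$ are monomials, neither dividing the other and neither a pure power of a variable, with $a_i+b_i>0$ and $e_i>\max\{a_i,b_i\}$ for all $i\in[n]$. Let $\mathcal{A}$ be the homogeneous matching of $G_I$ defined in the context. Then: (i) the directed graph $G_I^{\mathcal{A}}[V(\mathcal{A})]$ is acyclic; (ii) for any two distinct $\mathcal{A}$-critical vertices $T,T'$ of $G_I^{\mathcal{A}}$ we have $\mathbf{m}_T\ne\mathbf{m}_{T'}$. In particular, $\mathcal{A}$ is a BW-matching of $G_I$.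
   Context: Index the generators of $I$ by $[n+2]=\{1,\ldots,n+2\}$: generator $1$ is $u_1$, generator $2$ is $u_2$, and generator $i+2$ is $x_i^{e_i}$ for $i\in[n]$. For $T\subseteq[n+2]$, $\mathbf{m}_T$ is the lcm of the generators indexed by $T$, with $\mathbf{m}_\varnothing=1$. $G_I$ is the directed graph with vertex set $2^{[n+2]}$ and an edge $(T,T')$ from $T$ to $T'$ whenever $T'\subseteq T$ and $|T|=|T'|+1$; vertex $T$ is labeled $\mathbf{m}_T$. A matching $\mathcal{A}$ is a set of edges no two of which share a vertex; $V(\mathcal{A})$ is the set of vertices in edges of $\mathcal{A}$; it is homogeneous if $\mathbf{m}_T=\mathbf{m}_{T'}$ for all $(T,T')\in\mathcal{A}$. $G_I^{\mathcal{A}}$ is the directed graph obtained from $G_I$ by reversing all edges in $\mathcal{A}$; $G_I^{\mathcal A}[W]$ is the induced subgraph on $W$. $\mathcal{A}$ is acyclic if $G_I^{\mathcal{A}}$ (equivalently $G_I^{\mathcal{A}}[V(\mathcal{A})]$) has no directed cycle. Vertices not in $V(\mathcal{A})$ are called $\mathcal{A}$-critical. For $\mathcal{A}$-critical $T,T'$ with $|T|=|T'|+1$, write $\sigma_{T'}\preceq\sigma_T$ if $T'\subseteq T$, or there is a directed path from $T''$ to $T'$ in $G_I^{\mathcal{A}}$ for some $T''\subseteq T$ with $|T''|=|T'|$. A BW-matching is a homogeneous acyclic matching $\mathcal{A}$ such that $\mathbf{m}_T\neq\mathbf{m}_{T'}$ for any two $\mathcal{A}$-critical vertices $T,T'$ with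 $|T|=|T'|+1$ and $\sigma_{T'}\preceq\sigma_T$. Put $P_0=\{i+2: a_i=b_i\}$, $P_1=\{i+2: a_i>b_i\}$, $P_2=\{i+2: a_i<b_i\}$, $A=\{i+2: a_i>0\}$, $B=\{i+2: b_i>0\}$ ($i$ ranging over $[n]$). The matching $\mathcal{A}$ consists of the following edges of $G_I$: (1) $(T,T\setminus\{1\})$ with $1\in T$, $2\in T$, $P_1\subseteq T$; (2) $(T,T\setminus\{2\})$ with $1\in T$, $2\in T$, $P_1\not\subseteq T$, $P_2\subseteq T$; (3) $(T,T\setminus\{1\})$ with $1\in T$, $2\notin T$, $A\subseteq T$; (4) $(T,T\setminus\{2\})$ with $1\notin T$, $2\in T$, $B\subseteq T$, $T\ne[n+2]\setminus\{1\}$. *)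

theory Defs
  imports "HOL-Library.Poly_Mapping"
begin

section \<open>Monomials in a polynomial ring\<close>

text \<open>
  The monoid algebra of \<open>nat \<Rightarrow>\<^sub>0 nat\<close> over \<open>'k\<close> is the polynomial ring with one variable for
  each natural number. The ring \<open>K[x_1, ..., x_n]\<close> sits inside it, and divisibility between
  polynomials in \<open>x_1, ..., x_n\<close>, as well as lcms of monomials in these variables,
  are the same in both rings.
\<close>

type_synonym 'k mpoly = "(nat \<Rightarrow>\<^sub>0 nat) \<Rightarrow>\<^sub>0 'k"

definition var :: "nat \<Rightarrow> 'k::field mpoly" where
  "var i = Poly_Mapping.single (Poly_Mapping.single i 1) 1"

definition monomial :: "nat \<Rightarrow> (nat \<Rightarrow> nat) \<Rightarrow> 'k::field mpoly" where
  "monomial n c = (\<Prod>i\<in>{1..n}. var i ^ c i)"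

definition monomials :: "nat \<Rightarrow> 'k::field mpoly set" where
  "monomials n = range (monomial n)"

definition pure_power :: "nat \<Rightarrow> 'k::field mpoly \<Rightarrow> bool" where
  "pure_power n u \<longleftrightarrow> (\<exists>i\<in>{1..n}. \<exists>k\<ge>1. u = var i ^ k)"

text \<open>
  Least common multiples in the ring are determined only up to units; requiring a monomial
  (with coefficient 1) makes the choice unique. In particular the value at \<open>{}\<close> is 1.
\<close>

definition monomial_lcm :: "nat \<Rightarrow> 'k::field mpoly set \<Rightarrow> 'k mpoly" where
  "monomial_lcm n F = (THE m. m \<in> monomials n \<and> (\<forall>f\<in>F. f dvd m) \<and>
     (\<forall>p. (\<forall>f\<in>F. f dvd p) \<longrightarrow> m dvd p))"

definition generator ::
    "nat \<Rightarrow> (nat \<Rightarrow> nat) \<Rightarrow> (nat \<Rightarrow> nat) \<Rightarrow> (nat \<Rightarrow> nat) \<Rightarrow> nat \<Rightarrow> 'k::field mpoly" where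
  "generator n a b e j =
     (if j = 1 then monomial n a else if j = 2 then monomial n b else var (j - 2) ^ e (j - 2))"

definition lcm_label ::
    "nat \<Rightarrow> (nat \<Rightarrow> nat) \<Rightarrow> (nat \<Rightarrow> nat) \<Rightarrow> (nat \<Rightarrow> nat) \<Rightarrow> nat set \<Rightarrow> 'k::field mpoly" where
  "lcm_label n a b e T = monomial_lcm n (generator n a b e ` T)"


section \<open>Matchings of the Taylor graph\<close>

text \<open>
  Directed graphs are given by their edge relations. The graph on \<open>N\<close> generators has vertex
  set \<open>Pow {1..N}\<close>, and the vertex set of a matching \<open>M\<close> is \<open>Field M\<close>.
  The parameter \<open>m\<close> below is the labelling of the vertices.
\<close>

definition taylor_graph :: "nat \<Rightarrow> nat set rel" where
  "taylor_graph N = {(T, T'). T \<in> Pow {1..N} \<and> T' \<subseteq> T \<and> card T = card T' + 1}"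

definition matching_of :: "'v rel \<Rightarrow> 'v rel \<Rightarrow> bool" where
  "matching_of G M \<longleftrightarrow> M \<subseteq> G \<and>
     (\<forall>(T, T')\<in>M. \<forall>(U, U')\<in>M. (T, T') \<noteq> (U, U') \<longrightarrow> {T, T'} \<inter> {U, U'} = {})"

definition homogeneous :: "('v \<Rightarrow> 'm) \<Rightarrow> 'v rel \<Rightarrow> bool" where
  "homogeneous m M \<longleftrightarrow> (\<forall>(T, T')\<in>M. m T = m T')"

definition reverse_edges :: "'v rel \<Rightarrow> 'v rel \<Rightarrow> 'v rel" where
  "reverse_edges G M = (G - M) \<union> M\<inverse>"

definition induced_subgraph :: "'v rel \<Rightarrow> 'v set \<Rightarrow> 'v rel" where
  "induced_subgraph G W = G \<inter> W \<times> W"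

definition critical :: "nat \<Rightarrow> nat set rel \<Rightarrow> nat set \<Rightarrow> bool" where
  "critical N M T \<longleftrightarrow> T \<in> Pow {1..N} \<and> T \<notin> Field M"

text \<open>\<open>cell_le N M T' T\<close> is the relation \<open>\<sigma>\<^sub>T\<^sub>' \<preceq> \<sigma>\<^sub>T\<close>, meant for critical
  \<open>T\<close>, \<open>T'\<close> with \<open>card T = card T' + 1\<close>.\<close>

definition cell_le :: "nat \<Rightarrow> nat set rel \<Rightarrow> nat set \<Rightarrow> nat set \<Rightarrow> bool" where
  "cell_le N M T' T \<longleftrightarrow> T' \<subseteq> T \<or>
     (\<exists>T''. T'' \<subseteq> T \<and> card T'' = card T' \<and> (T'', T') \<in> (reverse_edges (taylor_graph N) M)\<^sup>*)"

definition BW_matching :: "nat \<Rightarrow> (nat set \<Rightarrow> 'm) \<Rightarrow> nat set rel \<Rightarrow> bool" where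
  "BW_matching N m M \<longleftrightarrow>
     matching_of (taylor_graph N) M \<and>
     homogeneous m M \<and>
     acyclic (reverse_edges (taylor_graph N) M) \<and>
     (\<forall>T T'. critical N M T \<and> critical N M T' \<and> card T = card T' + 1 \<and> cell_le N M T' T
        \<longrightarrow> m T \<noteq> m T')"


section \<open>The matching for two monomials and pure powers\<close>

definition P1 :: "nat \<Rightarrow> (nat \<Rightarrow> nat) \<Rightarrow> (nat \<Rightarrow> nat) \<Rightarrow> nat set" where
  "P1 n a b = {i + 2 |i. i \<in> {1..n} \<and> a i > b i}"

definition P2 :: "nat \<Rightarrow> (nat \<Rightarrow> nat) \<Rightarrow> (nat \<Rightarrow> nat) \<Rightarrow> nat set" where
  "P2 n a b = {i + 2 |i. i \<in> {1..n} \<and> a i < b i}"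

definition supp :: "nat \<Rightarrow> (nat \<Rightarrow> nat) \<Rightarrow> nat set" where
  "supp n c = {i + 2 |i. i \<in> {1..n} \<and> c i > 0}"

definition the_matching :: "nat \<Rightarrow> (nat \<Rightarrow> nat) \<Rightarrow> (nat \<Rightarrow> nat) \<Rightarrow> nat set rel" where
  "the_matching n a b =
     {(T, T - {1}) |T. T \<subseteq> {1..n+2} \<and> 1 \<in> T \<and> 2 \<in> T \<and> P1 n a b \<subseteq> T} \<union>
     {(T, T - {2}) |T. T \<subseteq> {1..n+2} \<and> 1 \<in> T \<and> 2 \<in> T \<and> \<not> P1 n a b \<subseteq> T \<and> P2 n a b \<subseteq> T} \<union>
     {(T, T - {1}) |T. T \<subseteq> {1..n+2} \<and> 1 \<in> T \<and> 2 \<notin> T \<and> supp n a \<subseteq> T} \<union>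
     {(T, T - {2}) |T. T \<subseteq> {1..n+2} \<and> 1 \<notin> T \<and> 2 \<in> T \<and> supp n b \<subseteq> T \<and> T \<noteq> {1..n+2} - {1}}"

end

theory Submission
  imports Defs
begin

text \<open>
  Every matched edge removes 1 or 2, so along a directed path of the modified graph the part of
  a vertex outside \<open>{1, 2}\<close> can only shrink. A cycle therefore stays inside one of the squares
  \<open>{Z, Z \<union> {1}, Z \<union> {2}, Z \<union> {1, 2}}\<close>, and going around a square would need two consecutive
  reversed edges, which share a vertex. As \<open>e i\<close> exceeds \<open>a i\<close> and \<open>b i\<close>, the label of \<open>T\<close>
  determines \<open>T - {1, 2}\<close>, so that (ii) also reduces to comparing the four vertices of a square.
\<close>

section \<open>Divisibility by monomials\<close>

text \<open>The exponent vector of \<open>monomial n c\<close> as a key of the polynomial ring;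
  values of \<open>c\<close> outside \<open>{1..n}\<close> are cut off.\<close>

definition exponent :: "nat \<Rightarrow> (nat \<Rightarrow> nat) \<Rightarrow> (nat \<Rightarrow>\<^sub>0 nat)" where
  "exponent n c = (\<Sum>i\<in>{1..n}. Poly_Mapping.single i (c i))"

lemma lookup_exponent: "Poly_Mapping.lookup (exponent n c) i = (if i \<in> {1..n} then c i else 0)"
  by (simp add: exponent_def lookup_sum lookup_single when_def)

lemma var_power: "(var i :: 'k::field mpoly) ^ k = Poly_Mapping.single (Poly_Mapping.single i k) 1"
proof (induction k)
  case 0
  then show ?case by simp
next
  case (Suc k)
  then show ?case
    by (simp add: var_def mult_single flip: single_add)
qed

lemma monomial_eq_single: "(monomial n c :: 'k::field mpoly) = Poly_Mapping.single (exponent n c) 1"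
proof -
  have "(\<Prod>i\<in>I. (var i :: 'k mpoly) ^ c i)
      = Poly_Mapping.single (\<Sum>i\<in>I. Poly_Mapping.single i (c i)) 1" if "finite I" for I
    using that by (induction I) (auto simp: var_power mult_single)
  then show ?thesis
    by (simp add: monomial_def exponent_def)
qed

lemma monomial_eq_iff:
  "(monomial n c :: 'k::field mpoly) = monomial n d \<longleftrightarrow> (\<forall>i\<in>{1..n}. c i = d i)"
proof
  assume "(monomial n c :: 'k mpoly) = monomial n d"
  then have "Poly_Mapping.keys (monomial n c :: 'k mpoly) = Poly_Mapping.keys (monomial n d :: 'k mpoly)"
    by simp
  then have "exponent n c = exponent n d"
    by (simp add: monomial_eq_single)
  then show "\<forall>i\<in>{1..n}. c i = d i"
    by (metis lookup_exponent)
qed (simp add: monomial_def)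

text \<open>Multiplying by \<open>Poly_Mapping.single s 1\<close> shifts every exponent vector by
  \<open>s\<close>, so a multiple has only terms above \<open>s\<close>; conversely each such term,
  hence their sum, is a multiple.\<close>

lemma single_dvd_iff:
  fixes p :: "'k::field mpoly"
  shows "Poly_Mapping.single s 1 dvd p \<longleftrightarrow> (\<forall>k\<in>Poly_Mapping.keys p. \<forall>i. Poly_Mapping.lookup s i \<le> Poly_Mapping.lookup k i)"
proof
  assume "Poly_Mapping.single s 1 dvd p"
  then obtain q where "p = Poly_Mapping.single s 1 * q" ..
  then have "Poly_Mapping.keys p \<subseteq> {s + k |k. k \<in> Poly_Mapping.keys q}"
    using keys_mult[of "Poly_Mapping.single s 1" q] by auto
  then show "\<forall>k\<in>Poly_Mapping.keys p. \<forall>i. Poly_Mapping.lookup s i \<le> Poly_Mapping.lookup k i"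
    by (auto simp: lookup_add)
next
  assume le: "\<forall>k\<in>Poly_Mapping.keys p. \<forall>i. Poly_Mapping.lookup s i \<le> Poly_Mapping.lookup k i"
  have "Poly_Mapping.single s 1 dvd Poly_Mapping.single k (Poly_Mapping.lookup p k)" if "k \<in> Poly_Mapping.keys p" for k
  proof -
    \<comment> \<open>The truncated subtraction is exact because \<open>s\<close> lies below
      \<open>k\<close> in every variable.\<close>
    have "k = s + (k - s)"
      using le that by (intro poly_mapping_eqI) (simp add: lookup_add lookup_minus)
    then have "Poly_Mapping.single k (Poly_Mapping.lookup p k)
        = Poly_Mapping.single s 1 * Poly_Mapping.single (k - s) (Poly_Mapping.lookup p k)"
      by (simp add: mult_single)
    then show ?thesis ..
  qed
  moreover have "p = (\<Sum>k\<in>Poly_Mapping.keys p. Poly_Mapping.single k (Poly_Mapping.lookup p k))"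
    by (rule poly_mapping_eqI)
      (simp add: lookup_sum lookup_single when_def in_keys_iff)
  ultimately show "Poly_Mapping.single s 1 dvd p"
    by (metis (no_types, lifting) dvd_sum)
qed

lemma monomial_dvd_iff:
  fixes p :: "'k::field mpoly"
  shows "monomial n c dvd p \<longleftrightarrow> (\<forall>k\<in>Poly_Mapping.keys p. \<forall>i\<in>{1..n}. c i \<le> Poly_Mapping.lookup k i)"
  by (auto simp: monomial_eq_single single_dvd_iff lookup_exponent)

lemma monomial_dvd_monomial_iff:
  "(monomial n c :: 'k::field mpoly) dvd monomial n d \<longleftrightarrow> (\<forall>i\<in>{1..n}. c i \<le> d i)"
  unfolding monomial_dvd_iff by (auto simp: monomial_eq_single lookup_exponent)

text \<open>Resolves the definite description: monomials that divide each other have equal exponents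
  and coefficient 1, so no unit remains free.\<close>

lemma monomial_lcm_eqI:
  fixes F :: "'k::field mpoly set"
  assumes dvd: "\<And>f. f \<in> F \<Longrightarrow> f dvd monomial n c"
    and least: "\<And>p. (\<And>f. f \<in> F \<Longrightarrow> f dvd p) \<Longrightarrow> monomial n c dvd p"
  shows "monomial_lcm n F = monomial n c"
  unfolding monomial_lcm_def
proof (rule the_equality)
  show "monomial n c \<in> monomials n \<and> (\<forall>f\<in>F. f dvd monomial n c) \<and>
      (\<forall>p. (\<forall>f\<in>F. f dvd p) \<longrightarrow> monomial n c dvd p)"
    using assms by (auto simp: monomials_def)
next
  fix m assume m: "m \<in> monomials n \<and> (\<forall>f\<in>F. f dvd m) \<and>
    (\<forall>p. (\<forall>f\<in>F. f dvd p) \<longrightarrow> m dvd p)"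
  then obtain d where d: "m = monomial n d"
    by (auto simp: monomials_def)
  have "m dvd monomial n c" "monomial n c dvd m"
    using m assms by auto
  then show "m = monomial n c"
    unfolding d monomial_eq_iff monomial_dvd_monomial_iff by (simp add: order_antisym)
qed


section \<open>The labels\<close>

text \<open>The exponent of variable \<open>i\<close> in the label. \<open>e i\<close> stands alone
  when \<open>i + 2\<close> is in \<open>T\<close>, since it will exceed \<open>a i\<close> and
  \<open>b i\<close>; an absent generator contributes 0.\<close>

definition label_exp ::
    "(nat \<Rightarrow> nat) \<Rightarrow> (nat \<Rightarrow> nat) \<Rightarrow> (nat \<Rightarrow> nat) \<Rightarrow> nat set \<Rightarrow> nat \<Rightarrow> nat" where
  "label_exp a b e T i = (if i + 2 \<in> T then e i
     else max (if 1 \<in> T then a i else 0) (if 2 \<in> T then b i else 0))"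

lemma var_power_eq_monomial:
  assumes "i \<in> {1..n}"
  shows "(var i :: 'k::field mpoly) ^ k = monomial n (\<lambda>j. if j = i then k else 0)"
proof -
  have "exponent n (\<lambda>j. if j = i then k else 0) = Poly_Mapping.single i k"
    using assms by (intro poly_mapping_eqI) (auto simp: lookup_exponent lookup_single when_def)
  then show ?thesis
    by (simp add: var_power monomial_eq_single)
qed

text \<open>Divisibility of \<open>p\<close> by a monomial is a lower bound on each exponent of each
  term of \<open>p\<close>, so the bounds from the single generators combine to their pointwise
  maximum.\<close>

lemma lcm_label_eq_monomial:
  assumes T: "T \<subseteq> {1..n + 2}" and e: "\<forall>i\<in>{1..n}. e i > max (a i) (b i)"
  shows "(lcm_label n a b e T :: 'k::field mpoly) = monomial n (label_exp a b e T)"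
  unfolding lcm_label_def
proof (rule monomial_lcm_eqI)
  fix f :: "'k mpoly" assume "f \<in> generator n a b e ` T"
  then obtain j where j: "j \<in> T" "f = generator n a b e j" by blast
  consider "j = 1" | "j = 2" | "j - 2 \<in> {1..n}" "j = (j - 2) + 2" "j \<noteq> 1" "j \<noteq> 2"
    using j T by fastforce
  then show "f dvd monomial n (label_exp a b e T)"
  proof cases
    case 3
    then show ?thesis
      using j by (auto simp: generator_def var_power_eq_monomial monomial_dvd_monomial_iff
          label_exp_def)
  qed (use j e in \<open>fastforce simp: generator_def monomial_dvd_monomial_iff label_exp_def\<close>)+
next
  fix p :: "'k mpoly" assume p: "\<And>f. f \<in> generator n a b e ` T \<Longrightarrow> f dvd p"
  show "monomial n (label_exp a b e T) dvd p"
    unfolding monomial_dvd_iff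
  proof (intro ballI)
    fix k i assume k: "k \<in> Poly_Mapping.keys p" and i: "i \<in> {1..n}"
    have "e i \<le> Poly_Mapping.lookup k i" if "i + 2 \<in> T"
    proof -
      have "generator n a b e (i + 2) dvd p" using p that by blast
      then have "monomial n (\<lambda>j. if j = i then e i else 0) dvd p"
        using i unfolding var_power_eq_monomial[OF i, symmetric]
        by (simp add: generator_def del: add_2_eq_Suc')
      \<comment> \<open>The divisibility criterion taken at the variable \<open>i\<close>
        itself.\<close>
      then have "(if i = i then e i else 0) \<le> Poly_Mapping.lookup k i"
        using k i unfolding monomial_dvd_iff by blast
      then show ?thesis by simp
    qed
    moreover have "a i \<le> Poly_Mapping.lookup k i" if "1 \<in> T"
    proof -
      have "generator n a b e 1 dvd p" using p that by blast
      then show ?thesis using k i by (auto simp: generator_def monomial_dvd_iff)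
    qed
    moreover have "b i \<le> Poly_Mapping.lookup k i" if "2 \<in> T"
    proof -
      have "generator n a b e 2 dvd p" using p that by blast
      then show ?thesis using k i by (auto simp: generator_def monomial_dvd_iff)
    qed
    ultimately show "label_exp a b e T i \<le> Poly_Mapping.lookup k i"
      by (simp add: label_exp_def)
  qed
qed


section \<open>Acyclicity\<close>

lemma matching_ofD:
  assumes "matching_of G M" "(T, T') \<in> M" "(U, U') \<in> M" "{T, T'} \<inter> {U, U'} \<noteq> {}"
  shows "T = U \<and> T' = U'"
  using assms unfolding matching_of_def by fast

text \<open>
  The values are chosen such that, within a square with fixed \<open>T - {x, y}\<close>, all edges of the
  modified graph go down.
\<close>

definition square_rank :: "'a \<Rightarrow> 'a \<Rightarrow> 'a set rel \<Rightarrow> 'a set \<Rightarrow> nat" where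
  "square_rank x y M T =
     (if x \<in> T \<and> y \<in> T then 6
      else if x \<in> T \<or> y \<in> T then (if T \<in> Range M then 7 else if T \<in> Domain M then 1 else 4)
      else if T \<in> Range M then 2 else 0)"

lemma square_rank_le: "square_rank x y M T \<le> 7"
  by (simp add: square_rank_def)

text \<open>Every edge strictly lowers a natural number \<open>f\<close>. A reversed edge keeps
  \<open>T - {x, y}\<close>; any other edge keeps it or deletes one of its elements.\<close>

lemma acyclic_reverse_edges:
  assumes M: "matching_of (taylor_graph N) M"
    and "x \<noteq> y"
    and xy: "\<And>T T'. (T, T') \<in> M \<Longrightarrow> T - T' \<subseteq> {x, y}"
  shows "acyclic (reverse_edges (taylor_graph N) M)"
proof -
  \<comment> \<open>Ranks are at most 7, so the factor 8 makes \<open>f\<close> compare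
    lexicographically: first the part outside \<open>{x, y}\<close>, then the rank.\<close>
  define f where "f T = 8 * card (T - {x, y}) + square_rank x y M T" for T
  have G: "\<exists>z. z \<in> T \<and> T' = T - {z} \<and> finite T" if "(T, T') \<in> taylor_graph N" for T T'
  proof -
    have T: "finite T" "T' \<subseteq> T" "card T = card T' + 1"
      using that finite_subset[of T "{1..N}"] by (auto simp: taylor_graph_def)
    then have "card (T - T') = 1"
      by (simp add: card_Diff_subset finite_subset)
    then obtain z where "T - T' = {z}"
      by (auto simp: card_1_singleton_iff)
    then show ?thesis using T by blast
  qed
  have MG: "M \<subseteq> taylor_graph N"
    using M by (simp add: matching_of_def)
  have "f U < f T" if TU: "(T, U) \<in> reverse_edges (taylor_graph N) M" for T U
  proof (cases "(U, T) \<in> M")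
    case True
    then obtain z where z: "z \<in> U" "T = U - {z}"
      using G MG by blast
    have "z \<in> {x, y}" using xy[OF True] z by blast
    then have "T - {x, y} = U - {x, y}" using z by blast
    moreover have "T \<in> Range M" "U \<in> Domain M" using True by auto
    \<comment> \<open>The rank drops from 7 to 6 or from 2 to 1; the value 1 requires that
      \<open>U\<close>, an upper end, is not also a lower end.\<close>
    moreover have "U \<notin> Range M"
    proof
      assume "U \<in> Range M"
      then obtain V where "(V, U) \<in> M" by blast
      then have "V = U \<and> U = T" using matching_ofD[OF M _ True] by blast
      then show False using z by blast
    qed
    moreover have "x \<in> T \<longleftrightarrow> x \<in> U \<and> x \<noteq> z" "y \<in> T \<longleftrightarrow> y \<in> U \<and> y \<noteq> z"
      using z by auto
    ultimately show ?thesis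
      using z(1) \<open>z \<in> {x, y}\<close> \<open>x \<noteq> y\<close> unfolding f_def square_rank_def by auto
  next
    case False
    then have TUG: "(T, U) \<in> taylor_graph N" "(T, U) \<notin> M"
      using TU by (auto simp: reverse_edges_def)
    then obtain z where z: "z \<in> T" "U = T - {z}" "finite T"
      using G by blast
    show ?thesis
    proof (cases "z \<in> {x, y}")
      case True
      then have eq: "U - {x, y} = T - {x, y}" using z by blast
      have mem: "x \<in> U \<longleftrightarrow> x \<in> T \<and> x \<noteq> z" "y \<in> U \<longleftrightarrow> y \<in> T \<and> y \<noteq> z"
        using z by auto
      \<comment> \<open>If \<open>U\<close> contains one of \<open>x\<close>, \<open>y\<close>, its
        rank must not be 7. An edge matching \<open>U\<close> from above removes some
        \<open>w\<close>, which differs from \<open>z\<close> because \<open>(T, U)\<close> is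
        unmatched, so a matched \<open>U\<close> would lack both \<open>x\<close> and
        \<open>y\<close>.\<close>
      have up: "x \<notin> U" "y \<notin> U" if U: "U \<in> Range M"
      proof -
        obtain V where V: "(V, U) \<in> M" using U by blast
        then obtain w where w: "w \<in> V" "U = V - {w}" using G MG by blast
        have "w \<in> {x, y}" using xy[OF V] w by blast
        have "w \<notin> U" using w by blast
        have "V = insert w U" "T = insert z U" using w z by blast+
        then have "w \<noteq> z" using TUG V by auto
        then show "x \<notin> U" "y \<notin> U" using True mem \<open>w \<in> {x, y}\<close> \<open>w \<notin> U\<close> by auto
      qed
      \<comment> \<open>If \<open>U\<close> contains neither, the rank of \<open>T\<close> must not
        be 1: a matched edge leaving \<open>T\<close> would remove an element other than
        \<open>z\<close>, but \<open>z\<close> is the only one of \<open>x\<close>, \<open>y\<close>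
        in \<open>T\<close>.\<close>
      have D: "T \<notin> Domain M" if "x \<notin> U" "y \<notin> U"
      proof
        assume "T \<in> Domain M"
        then obtain V where V: "(T, V) \<in> M" by blast
        then obtain v where v: "v \<in> T" "V = T - {v}" using G MG by blast
        have "v \<in> {x, y}" using xy[OF V] v by blast
        moreover have "v \<noteq> z" using TUG V v(2) z(2) by auto
        ultimately show False using that v z by auto
      qed
      have "square_rank x y M U < square_rank x y M T"
        using True z(1) \<open>x \<noteq> y\<close> mem up D unfolding square_rank_def
        by (cases "U \<in> Range M") auto
      then show ?thesis by (simp add: f_def eq)
    next
      case False
      then have "U - {x, y} = (T - {x, y}) - {z}" "z \<in> T - {x, y}" using z by auto
      then have "card (U - {x, y}) < card (T - {x, y})"
        using z by (simp only: card_Diff1_less finite_Diff)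
      then show ?thesis
        using square_rank_le[of x y M U] by (simp add: f_def)
    qed
  qed
  then have "reverse_edges (taylor_graph N) M \<subseteq> (measure f)\<inverse>"
    by auto
  then show ?thesis
    by (meson acyclic_converse acyclic_subset wf_acyclic wf_measure)
qed


section \<open>The matching\<close>

lemma the_matching_taylor_graph: "the_matching n a b \<subseteq> taylor_graph (n + 2)"
proof -
  have "(T, T - {x}) \<in> taylor_graph (n + 2)" if "T \<subseteq> {1..n + 2}" "x \<in> T" for T x
  proof -
    have "finite T" using that finite_subset by blast
    then have "card T = card (T - {x}) + 1"
      using that by (metis Suc_eq_plus1 card.remove)
    then show ?thesis using that by (auto simp: taylor_graph_def)
  qed
  then show ?thesis unfolding the_matching_def by blast
qed

section \<open>Disjointness of the matched edges\<close>

lemma full_subsetI: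
  fixes T :: "nat set"
  assumes "\<And>i. i \<in> {1..n} \<Longrightarrow> i + 2 \<in> T"
  shows "{3..n + 2} \<subseteq> T"
proof
  fix j assume "j \<in> {3..n + 2}"
  then have "j - 2 \<in> {1..n}" "j = (j - 2) + 2" by auto
  then show "j \<in> T" using assms by metis
qed

text \<open>If \<open>a i > b i\<close> fails, then \<open>a i + b i > 0\<close> forces
  \<open>b i > 0\<close>. This covering and the two that follow show that clashing matching
  conditions put all pure-power generators into one vertex.\<close>

lemma P1_supp_full:
  assumes "\<forall>i\<in>{1..n}. a i + b i > 0" "P1 n a b \<subseteq> T" "supp n b \<subseteq> T"
  shows "{3..n + 2} \<subseteq> T"
proof (rule full_subsetI)
  fix i assume i: "i \<in> {1..n}"
  then have "a i > b i \<or> b i > 0" using assms(1) by fastforce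
  then have "i + 2 \<in> P1 n a b \<union> supp n b" using i unfolding P1_def supp_def by blast
  then show "i + 2 \<in> T" using assms(2,3) by blast
qed

lemma P2_supp_full:
  assumes "\<forall>i\<in>{1..n}. a i + b i > 0" "P2 n a b \<subseteq> T" "supp n a \<subseteq> T"
  shows "{3..n + 2} \<subseteq> T"
proof (rule full_subsetI)
  fix i assume i: "i \<in> {1..n}"
  then have "a i < b i \<or> a i > 0" using assms(1) by fastforce
  then have "i + 2 \<in> P2 n a b \<union> supp n a" using i unfolding P2_def supp_def by blast
  then show "i + 2 \<in> T" using assms(2,3) by blast
qed

lemma supp_supp_full:
  assumes "\<forall>i\<in>{1..n}. a i + b i > 0" "supp n a \<subseteq> T" "supp n b \<subseteq> T"
  shows "{3..n + 2} \<subseteq> T"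
proof (rule full_subsetI)
  fix i assume i: "i \<in> {1..n}"
  then have "a i > 0 \<or> b i > 0" using assms(1) by fastforce
  then have "i + 2 \<in> supp n a \<union> supp n b" using i unfolding supp_def by blast
  then show "i + 2 \<in> T" using assms(2,3) by blast
qed

lemma P1_subset: "P1 n a b \<subseteq> {3..n + 2}"
  and P2_subset: "P2 n a b \<subseteq> {3..n + 2}"
  and supp_subset: "supp n c \<subseteq> {3..n + 2}"
  by (auto simp: P1_def P2_def supp_def)

text \<open>Groups the four families by the removed element, the first with the third and the second
  with the fourth.\<close>

lemma the_matching_iff:
  "(T, T') \<in> the_matching n a b \<longleftrightarrow> T \<subseteq> {1..n + 2} \<and>
     (T' = T - {1} \<and> 1 \<in> T \<and> (if 2 \<in> T then P1 n a b \<subseteq> T else supp n a \<subseteq> T) \<or>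
      T' = T - {2} \<and> 2 \<in> T \<and> (if 1 \<in> T then \<not> P1 n a b \<subseteq> T \<and> P2 n a b \<subseteq> T
        else supp n b \<subseteq> T \<and> T \<noteq> {1..n + 2} - {1}))"
  unfolding the_matching_def by auto

text \<open>Two edges may share an upper end, share a lower end, or form a path. The first case is
  settled by comparing conditions; conflicts of the other kinds force all pure-power generators into
  a vertex.\<close>

lemma matching_of_the_matching:
  assumes ab: "\<forall>i\<in>{1..n}. a i + b i > 0"
  shows "matching_of (taylor_graph (n + 2)) (the_matching n a b)"
proof -
  let ?M = "the_matching n a b"
  note subs = P1_subset[of n a b] P2_subset[of n a b] supp_subset[of n a] supp_subset[of n b]
  \<comment> \<open>This is the vertex exempted from the fourth family.\<close>
  have full: "U = {1..n + 2} - {1}" if "{3..n + 2} \<subseteq> U" "2 \<in> U" "1 \<notin> U" "U \<subseteq> {1..n + 2}" for U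
  proof -
    have "{1..n + 2} - {1} = insert 2 {3..n + 2}" by auto
    then show ?thesis using that by auto
  qed
  \<comment> \<open>The sets in the conditions avoid 1 and 2, so the conditions carry over between
    vertices of one square.\<close>
  have ignore: "S \<subseteq> V \<longleftrightarrow> S \<subseteq> W" if "S \<subseteq> {3..n + 2}" "V - {1, 2} = W - {1, 2}" for S V W :: "nat set"
    using that by fastforce
  have upper: "T' = U'" if "(T, T') \<in> ?M" "(T, U') \<in> ?M" for T T' U'
    using that unfolding the_matching_iff by (auto split: if_splits)
  have middle: False if TU: "(T, U) \<in> ?M" and UV: "(U, V) \<in> ?M" for T U V
  proof -
    have "T - {1, 2} = U - {1, 2}" using TU unfolding the_matching_iff by blast
    note eq = ignore[OF _ this]
    \<comment> \<open>Edges of the third and fourth families end in vertices without 1 and 2. So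
      \<open>(T, U)\<close> is of the first family and \<open>(U, V)\<close> of the fourth, making
      \<open>U\<close> the exempted vertex, or they are of the second and third, and then
      \<open>T\<close> contains \<open>P1\<close> after all.\<close>
    consider "1 \<in> T" "2 \<in> T" "P1 n a b \<subseteq> T" "U = T - {1}" "supp n b \<subseteq> U" "U \<noteq> {1..n + 2} - {1}"
      | "1 \<in> T" "2 \<in> T" "\<not> P1 n a b \<subseteq> T" "P2 n a b \<subseteq> T" "U = T - {2}" "supp n a \<subseteq> U"
      using TU UV unfolding the_matching_iff by (auto split: if_splits)
    then show False
    proof cases
      case 1
      then have "P1 n a b \<subseteq> U" using eq subs by blast
      then have "{3..n + 2} \<subseteq> U" using 1 ab by (intro P1_supp_full) auto
      then show False using full[of U] 1 UV unfolding the_matching_iff by auto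
    next
      case 2
      then have "{3..n + 2} \<subseteq> T" using ab eq subs by (intro P2_supp_full[of n a b]) auto
      then show False using 2 subs by blast
    qed
  qed
  have lower: "T = U" if TV: "(T, V) \<in> ?M" and UV: "(U, V) \<in> ?M" for T U V
  proof -
    \<comment> \<open>Different removed elements mean a third-family and a fourth-family edge ending
      in \<open>V\<close>; the two supports together make \<open>U\<close> the exempted
      vertex.\<close>
    have F: False if TV: "(T, V) \<in> ?M" "1 \<in> T" "V = T - {1}"
      and UV: "(U, V) \<in> ?M" "2 \<in> U" "V = U - {2}" for T U
    proof -
      have "1 \<notin> V" unfolding TV(3) by simp
      have "2 \<notin> V" unfolding UV(3) by simp
      have mem: "1 \<notin> U" using \<open>1 \<notin> V\<close> unfolding UV(3) by simp
      have mem': "2 \<notin> T" using \<open>2 \<notin> V\<close> unfolding TV(3) by simp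
      have "T - {1, 2} = V - {1, 2}" using TV(3) by blast
      also have "\<dots> = U - {1, 2}" using UV(3) by blast
      finally have eq: "T - {1, 2} = U - {1, 2}" .
      have A: "supp n a \<subseteq> T" using TV(1) mem' unfolding the_matching_iff by auto
      have B: "supp n b \<subseteq> U" "U \<subseteq> {1..n + 2}" "U \<noteq> {1..n + 2} - {1}"
        using UV(1,2) mem TV(3) unfolding the_matching_iff by auto
      have "supp n a \<subseteq> U" using A ignore[OF subs(3) eq] by simp
      then have "{3..n + 2} \<subseteq> U" by (rule supp_supp_full[OF ab _ B(1)])
      then show False using full[of U] B UV(2) mem by blast
    qed
    have obt: "1 \<in> T \<and> V = T - {1} \<or> 2 \<in> T \<and> V = T - {2}" if "(T, V) \<in> ?M" for T
      using that unfolding the_matching_iff by blast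
    consider "1 \<in> T" "1 \<in> U" "T - {1} = U - {1}" | "2 \<in> T" "2 \<in> U" "T - {2} = U - {2}"
      using obt[OF TV] obt[OF UV] F[OF TV _ _ UV] F[OF UV _ _ TV] by metis
    then show ?thesis
      by cases (metis insert_Diff)+
  qed
  have disj: "T = U \<and> T' = U'"
    if "(T, T') \<in> ?M" "(U, U') \<in> ?M" and ne: "{T, T'} \<inter> {U, U'} \<noteq> {}" for T T' U U'
  proof -
    consider "T = U" | "T = U'" | "T' = U" | "T' = U'" using ne by blast
    then show ?thesis
    proof cases
      case 1
      then show ?thesis using that upper by blast
    next
      case 2
      then show ?thesis using that middle by blast
    next
      case 3
      then show ?thesis using that middle by blast
    next
      case 4
      then show ?thesis using that lower by blast
    qed
  qed
  show ?thesis
    unfolding matching_of_def case_prod_beta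
  proof (intro conjI the_matching_taylor_graph ballI impI)
    fix E F assume "E \<in> ?M" "F \<in> ?M" "(fst E, snd E) \<noteq> (fst F, snd F)"
    then show "{fst E, snd E} \<inter> {fst F, snd F} = {}"
      using disj[of "fst E" "snd E" "fst F" "snd F"] by (metis prod.collapse)
  qed
qed

section \<open>Homogeneity of the matching\<close>

lemma homogeneous_the_matching:
  assumes e: "\<forall>i\<in>{1..n}. e i > max (a i) (b i)"
  shows "homogeneous (lcm_label n a b e :: nat set \<Rightarrow> 'k::field mpoly) (the_matching n a b)"
  unfolding homogeneous_def
proof (intro ballI, safe)
  fix T T' assume M: "(T, T') \<in> the_matching n a b"
  then have T: "T \<subseteq> {1..n + 2}" "T' \<subseteq> {1..n + 2}" unfolding the_matching_iff by auto
  have "label_exp a b e T i = label_exp a b e T' i" if i: "i \<in> {1..n}" for i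
  proof -
    \<comment> \<open>Ensures that \<open>i + 2\<close> is not the removable element 2.\<close>
    have "i \<noteq> 0" using i by simp
    \<comment> \<open>Removing 1 or 2 can matter only where \<open>i + 2\<close> is missing from
      \<open>T\<close>; there the conditions make the lost exponent zero or at most the one that
      stays.\<close>
    have "P1 n a b \<subseteq> T \<Longrightarrow> i + 2 \<in> T \<or> a i \<le> b i" "P2 n a b \<subseteq> T \<Longrightarrow> i + 2 \<in> T \<or> b i \<le> a i"
      "supp n a \<subseteq> T \<Longrightarrow> i + 2 \<in> T \<or> a i = 0" "supp n b \<subseteq> T \<Longrightarrow> i + 2 \<in> T \<or> b i = 0"
      using i by (fastforce simp: P1_def P2_def supp_def)+
    from this M show ?thesis
      using \<open>i \<noteq> 0\<close> unfolding the_matching_iff by (auto simp: label_exp_def max_def split: if_splits)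
  qed
  then show "(lcm_label n a b e T :: 'k mpoly) = lcm_label n a b e T'"
    by (simp add: lcm_label_eq_monomial[OF T(1) e] lcm_label_eq_monomial[OF T(2) e] monomial_eq_iff)
qed

section \<open>Critical vertices and their labels\<close>

lemma critical_the_matching:
  assumes "critical (n + 2) (the_matching n a b) T"
  shows "T \<subseteq> {1..n + 2}"
    and "1 \<in> T \<Longrightarrow> 2 \<in> T \<Longrightarrow> \<not> P1 n a b \<subseteq> T \<and> \<not> P2 n a b \<subseteq> T"
    and "1 \<in> T \<Longrightarrow> 2 \<notin> T \<Longrightarrow> \<not> supp n a \<subseteq> T"
    and "1 \<notin> T \<Longrightarrow> 2 \<in> T \<Longrightarrow> \<not> P1 n a b \<subseteq> T \<and> \<not> supp n b \<subseteq> T"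
    and "1 \<notin> T \<Longrightarrow> 2 \<notin> T \<Longrightarrow> \<not> supp n a \<subseteq> T \<and> \<not> supp n b \<subseteq> T"
proof -
  show T: "T \<subseteq> {1..n + 2}" using assms by (simp add: critical_def)
  \<comment> \<open>A critical vertex is neither an upper end (\<open>D\<close>) nor a lower end
    (\<open>R\<close>) of a matched edge; the claims come from removing or inserting 1 or 2.\<close>
  have D: "(T, U) \<notin> the_matching n a b" and R: "(U, T) \<notin> the_matching n a b" for U
    using assms by (auto simp: critical_def Field_def)
  have ins: "insert 1 T \<subseteq> {1..n + 2}" "insert 2 T \<subseteq> {1..n + 2}" using T by auto
  have sub: "S \<subseteq> insert 1 T \<longleftrightarrow> S \<subseteq> T" "S \<subseteq> insert 2 T \<longleftrightarrow> S \<subseteq> T"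
    if "S \<subseteq> {3..n + 2}" for S
    using that by (auto intro!: subset_insert)
  note sub = sub[OF P1_subset[of n a b]] sub[OF supp_subset[of n a]] sub[OF supp_subset[of n b]]
  have R1: "if 2 \<in> T then \<not> P1 n a b \<subseteq> T else \<not> supp n a \<subseteq> T" if "1 \<notin> T"
  proof -
    have "insert 1 T - {1} = T" using that by simp
    then show ?thesis
      using R[of "insert 1 T"] ins(1) unfolding the_matching_iff sub by (simp split: if_splits)
  qed
  \<comment> \<open>A missing pure-power generator shows that the vertex is not the one exempted
    from the fourth family, so it is the support condition of that family that fails.\<close>
  have full: "V \<noteq> {1..n + 2} - {1}"
    if not: "\<not> S \<subseteq> T" and S: "S \<subseteq> {3..n + 2}" and V: "V \<subseteq> insert 2 T" for S V
  proof -
    obtain j where j: "j \<in> S" "j \<notin> T" using not by blast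
    then have "j \<in> {3..n + 2}" using S by blast
    then have "j \<in> {1..n + 2} - {1}" "j \<noteq> 2" by auto
    then show ?thesis using j V by blast
  qed
  show "1 \<in> T \<Longrightarrow> 2 \<in> T \<Longrightarrow> \<not> P1 n a b \<subseteq> T \<and> \<not> P2 n a b \<subseteq> T"
    using D[of "T - {1}"] D[of "T - {2}"] T unfolding the_matching_iff by auto
  show "1 \<in> T \<Longrightarrow> 2 \<notin> T \<Longrightarrow> \<not> supp n a \<subseteq> T"
    using D[of "T - {1}"] T unfolding the_matching_iff by auto
  show "\<not> P1 n a b \<subseteq> T \<and> \<not> supp n b \<subseteq> T" if "1 \<notin> T" "2 \<in> T"
  proof -
    have P: "\<not> P1 n a b \<subseteq> T" using R1 that by simp
    then show ?thesis
      using D[of "T - {2}"] T that full[OF P P1_subset, of T] unfolding the_matching_iff by auto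
  qed
  show "\<not> supp n a \<subseteq> T \<and> \<not> supp n b \<subseteq> T" if "1 \<notin> T" "2 \<notin> T"
  proof -
    have A: "\<not> supp n a \<subseteq> T" using R1 that by simp
    have "insert 2 T - {2} = T" using that by simp
    then have "\<not> supp n b \<subseteq> T"
      using R[of "insert 2 T"] ins(2) that full[OF A supp_subset, of "insert 2 T"]
      unfolding the_matching_iff sub by simp
    then show ?thesis using A by blast
  qed
qed

text \<open>Equal labels put both vertices into one square. By criticality \<open>P1\<close>,
  \<open>P2\<close> or the supports are not contained in the vertex, which supplies variables whose
  exponents reveal which of 1 and 2 are present.\<close>

lemma label_exp_inj_critical:
  assumes e: "\<forall>i\<in>{1..n}. e i > max (a i) (b i)"
    and T: "critical (n + 2) (the_matching n a b) T"
    and U: "critical (n + 2) (the_matching n a b) U"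
    and eq: "\<forall>i\<in>{1..n}. label_exp a b e T i = label_exp a b e U i"
  shows "T = U"
proof -
  have mem: "i + 2 \<in> T \<longleftrightarrow> i + 2 \<in> U" if i: "i \<in> {1..n}" for i
  proof -
    have "i + 2 \<in> V \<longleftrightarrow> label_exp a b e V i = e i" for V
    proof -
      have "max (if 1 \<in> V then a i else 0) (if 2 \<in> V then b i else 0) \<le> max (a i) (b i)"
        by (intro max.mono) auto
      also have "\<dots> < e i" using e i by blast
      finally show ?thesis unfolding label_exp_def by (metis less_irrefl)
    qed
    then show ?thesis using eq i by metis
  qed
  have mem3: "j \<in> T \<longleftrightarrow> j \<in> U" if "j \<noteq> 1" "j \<noteq> 2" for j
  proof (cases "j \<in> {3..n + 2}")
    case True
    then have "j - 2 \<in> {1..n}" "j = (j - 2) + 2" by auto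
    then show ?thesis using mem by metis
  next
    case False
    then have "j \<notin> {1..n + 2}" using that by auto
    then show ?thesis using critical_the_matching(1)[OF T] critical_the_matching(1)[OF U] by blast
  qed
  have P1: "\<exists>i\<in>{1..n}. i + 2 \<notin> V \<and> a i > b i" if "\<not> P1 n a b \<subseteq> V" for V
    using that by (auto simp: P1_def)
  have P2: "\<exists>i\<in>{1..n}. i + 2 \<notin> V \<and> a i < b i" if "\<not> P2 n a b \<subseteq> V" for V
    using that by (auto simp: P2_def)
  have S: "\<exists>i\<in>{1..n}. i + 2 \<notin> V \<and> c i > 0" if "\<not> supp n c \<subseteq> V" for V c
    using that by (auto simp: supp_def)
  \<comment> \<open>Used for \<open>(T, U)\<close> and \<open>(U, T)\<close>, these implications
    tell apart the four possible intersections with \<open>{1, 2}\<close>.\<close>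
  have le: "1 \<in> V \<and> 2 \<in> V \<longrightarrow> 1 \<in> W \<and> 2 \<in> W" "1 \<in> V \<or> 2 \<in> V \<longrightarrow> 1 \<in> W \<or> 2 \<in> W"
    "2 \<in> V \<and> 1 \<notin> V \<longrightarrow> 2 \<in> W"
    if V: "critical (n + 2) (the_matching n a b) V"
    and mem: "\<forall>i\<in>{1..n}. i + 2 \<in> V \<longleftrightarrow> i + 2 \<in> W"
    and eq: "\<forall>i\<in>{1..n}. label_exp a b e V i = label_exp a b e W i" for V W
  proof -
    note c = critical_the_matching[OF V]
    have eq': "max (if 1 \<in> V then a i else 0) (if 2 \<in> V then b i else 0)
        = max (if 1 \<in> W then a i else 0) (if 2 \<in> W then b i else 0)"
      if "i \<in> {1..n}" "i + 2 \<notin> V" for i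
      using eq mem that unfolding label_exp_def by metis
    show "1 \<in> V \<and> 2 \<in> V \<longrightarrow> 1 \<in> W \<and> 2 \<in> W"
    proof
      assume 12: "1 \<in> V \<and> 2 \<in> V"
      \<comment> \<open>At \<open>i\<close> the exponent \<open>a i\<close> exceeds
        \<open>b i\<close>, so \<open>W\<close> contains 1; at \<open>j\<close> the roles are
        swapped.\<close>
      obtain i where i: "i \<in> {1..n}" "i + 2 \<notin> V" "a i > b i" using P1 c(2) 12 by blast
      obtain j where j: "j \<in> {1..n}" "j + 2 \<notin> V" "a j < b j" using P2 c(2) 12 by blast
      show "1 \<in> W \<and> 2 \<in> W"
        using eq'[OF i(1,2)] eq'[OF j(1,2)] i(3) j(3) 12 by (auto split: if_splits)
    qed
    show "1 \<in> V \<or> 2 \<in> V \<longrightarrow> 1 \<in> W \<or> 2 \<in> W"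
    proof
      assume 12: "1 \<in> V \<or> 2 \<in> V"
      obtain i where i: "i \<in> {1..n}" "i + 2 \<notin> V"
        "max (if 1 \<in> V then a i else 0) (if 2 \<in> V then b i else 0) > 0"
      proof (cases "1 \<in> V")
        case True
        \<comment> \<open>The first alternative arises when 2 is also in \<open>V\<close>, and
          \<open>a i > b i\<close> then gives positivity; the second arises when it is not.\<close>
        then have "\<not> P1 n a b \<subseteq> V \<or> \<not> supp n a \<subseteq> V" using c by blast
        then obtain i where "i \<in> {1..n}" "i + 2 \<notin> V" "a i > 0"
          using P1[of V] S[of a V] by (metis less_zeroE neq0_conv)
        then show ?thesis using that[of i] True by simp
      next
        case False
        then have "\<not> supp n b \<subseteq> V" using c 12 by blast
        then obtain i where "i \<in> {1..n}" "i + 2 \<notin> V" "b i > 0" using S by blast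
        then show ?thesis using that[of i] False 12 by simp
      qed
      then show "1 \<in> W \<or> 2 \<in> W"
        using eq'[OF i(1,2)] by (auto split: if_splits)
    qed
    show "2 \<in> V \<and> 1 \<notin> V \<longrightarrow> 2 \<in> W"
    proof
      assume 21: "2 \<in> V \<and> 1 \<notin> V"
      \<comment> \<open>At \<open>i\<close> the exponent is \<open>b i\<close>, below
        \<open>a i\<close>, so 1 is not in \<open>W\<close>; the positive exponent at
        \<open>j\<close> must then come from 2.\<close>
      then obtain i where i: "i \<in> {1..n}" "i + 2 \<notin> V" "a i > b i" using P1 c(4) by blast
      obtain j where j: "j \<in> {1..n}" "j + 2 \<notin> V" "b j > 0" using S c(4) 21 by blast
      show "2 \<in> W"
        using eq'[OF i(1,2)] eq'[OF j(1,2)] i(3) j(3) 21 by (auto split: if_splits)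
    qed
  qed
  have TU: "\<forall>i\<in>{1..n}. i + 2 \<in> T \<longleftrightarrow> i + 2 \<in> U" using mem by blast
  have UT: "\<forall>i\<in>{1..n}. i + 2 \<in> U \<longleftrightarrow> i + 2 \<in> T" using mem by blast
  have eq': "\<forall>i\<in>{1..n}. label_exp a b e U i = label_exp a b e T i" using eq by simp
  have "1 \<in> T \<longleftrightarrow> 1 \<in> U" "2 \<in> T \<longleftrightarrow> 2 \<in> U"
    using le[OF T TU eq] le[OF U UT eq'] by blast+
  then show ?thesis using mem3 by (metis set_eqI)
qed

theorem theorem5p4:
  fixes n :: nat and a b e :: "nat \<Rightarrow> nat" and u1 u2 :: "'k::field mpoly"
    and m :: "nat set \<Rightarrow> 'k mpoly"
  defines "u1 \<equiv> monomial n a" and "u2 \<equiv> monomial n b" and "m \<equiv> lcm_label n a b e"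
  assumes "\<not> u1 dvd u2" and "\<not> u2 dvd u1"
    and "\<not> pure_power n u1" and "\<not> pure_power n u2"
    and "\<forall>i\<in>{1..n}. a i + b i > 0"
    and "\<forall>i\<in>{1..n}. e i > max (a i) (b i)"
  shows "acyclic (induced_subgraph
           (reverse_edges (taylor_graph (n + 2)) (the_matching n a b))
           (Field (the_matching n a b)))
    \<and> (\<forall>T T'. critical (n + 2) (the_matching n a b) T \<and> critical (n + 2) (the_matching n a b) T'
          \<and> T \<noteq> T' \<longrightarrow> m T \<noteq> m T')
    \<and> BW_matching (n + 2) m (the_matching n a b)"
proof -
  let ?M = "the_matching n a b"
  note ab = assms(8) and e = assms(9)
  have matching: "matching_of (taylor_graph (n + 2)) ?M"
    using matching_of_the_matching[OF ab] .
  have acyclic: "acyclic (reverse_edges (taylor_graph (n + 2)) ?M)"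
    using matching by (rule acyclic_reverse_edges[where x = 1 and y = 2])
      (auto simp: the_matching_iff)
  then have "acyclic (induced_subgraph (reverse_edges (taylor_graph (n + 2)) ?M) (Field ?M))"
    by (rule acyclic_subset) (simp add: induced_subgraph_def)
  moreover have inj: "m T \<noteq> m T'"
    if "critical (n + 2) ?M T" "critical (n + 2) ?M T'" "T \<noteq> T'" for T T'
    using label_exp_inj_critical[OF e that(1,2)] that(3)
    unfolding m_def lcm_label_eq_monomial[OF critical_the_matching(1)[OF that(1)] e]
      lcm_label_eq_monomial[OF critical_the_matching(1)[OF that(2)] e] monomial_eq_iff
    by blast
  \<comment> \<open>Different cardinalities make the vertices distinct, so (ii) yields the label
    condition of a BW-matching.\<close>
  moreover have "m T \<noteq> m T'"
    if "critical (n + 2) ?M T" "critical (n + 2) ?M T'" "card T = card T' + 1" for T T'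
    using inj[OF that(1,2)] that(3) by fastforce
  ultimately show ?thesis
    using matching acyclic homogeneous_the_matching[OF e, where 'k = 'k]
    unfolding BW_matching_def m_def by blast
qed

end
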